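(* The following hold. (i) $AA^*-A^*A=2\mathbf{i}A^{\varepsilon}$; (ii) $A^*A^{\varepsilon}-A^{\varepsilon}A^*=2\mathbf{i}A$; (iii) $A^{\varepsilon}A-AA^{\varepsilon}=2\mathbf{i}A^*$.
   Context: Let $D$ be a positive integer and let $Q_D$ be the $D$-cube: the graph with vertex set $X=\{0,1\}^D$, two vertices being adjacent iff they differ in exactly one coordinate; $\partial$ denotes path-length distance. $\mathrm{Mat}_X(\mathbb{C})$ is the algebra of complex matrices with rows and columns indexed by $X$. Write $\mathbf{i}^2=-1$. Let $A$ be the adjacency matrix of $Q_D$. Fix $x=(0,0,\ldots,0)\in X$. Let $A^*$ be the diagonal matrix in $\mathrm{Mat}_X(\mathbb{C})$ with $(y,y)$-entry $D-2\partial(x,y)$ for $y\in X$ (the dual adjacency matrix). Let $A^{\varepsilon}=-\mathbf{i}(AA^*-A^*A)/2$ (the imaginary adjacency matrix). *)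

theory Defs
  imports "HOL-Analysis.Analysis" "Graph_Theory.Graph_Theory"
begin

text \<open>
  The vertex set is represented by the type \<open>bool ^ 'd\<close>, with \<open>False\<close> for 0 and \<open>True\<close> for 1,
  so that \<open>D = CARD('d)\<close>, which is automatically positive.
\<close>

definition cube :: "(bool ^ 'd) pair_pre_digraph" where
  "cube = \<lparr> pverts = UNIV, parcs = {(y, z). \<exists>!i. y $ i \<noteq> z $ i} \<rparr>"

lemma pair_graph_cube: "pair_graph (cube :: (bool ^ 'd) pair_pre_digraph)"
proof
  have "(\<exists>!i. y $ i \<noteq> z $ i) \<longleftrightarrow> (\<exists>!i. z $ i \<noteq> y $ i)" for y z :: "bool ^ 'd"
    by (simp only: neq_commute)
  then show "symmetric (with_proj (cube :: (bool ^ 'd) pair_pre_digraph))"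
    unfolding symmetric_def with_proj_simps cube_def
    by (intro symI) (simp only: pair_pre_digraph.simps mem_Collect_eq prod.case)
qed (auto simp: cube_def)

text \<open>
  Path-length distance is the least cost of a walk, each arc having cost 1. The library's
  \<open>wf_digraph.\<mu>\<close> takes extended real values, being infinite between different components.
\<close>

definition path_dist :: "('a, 'b) pre_digraph \<Rightarrow> 'a \<Rightarrow> 'a \<Rightarrow> real" where
  "path_dist G u v = real_of_ereal (wf_digraph.\<mu> G (\<lambda>_. 1) u v)"

definition adjacency_matrix :: "('v::finite, 'b) pre_digraph \<Rightarrow> complex ^ 'v ^ 'v" where
  "adjacency_matrix G = (\<chi> y z. if y \<rightarrow>\<^bsub>G\<^esub> z then 1 else 0)"

definition dual_adjacency_matrix :: "bool ^ 'd \<Rightarrow> complex ^ (bool ^ 'd) ^ (bool ^ 'd)" where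
  "dual_adjacency_matrix x =
     (\<chi> y z. if y = z then of_real (real CARD('d) - 2 * path_dist cube x y) else 0)"

abbreviation cscale :: "complex \<Rightarrow> complex ^ 'n ^ 'm \<Rightarrow> complex ^ 'n ^ 'm" (infixr \<open>*\<^sub>m\<close> 75) where
  "c *\<^sub>m M \<equiv> map_matrix ((*) c) M"

definition imaginary_adjacency_matrix :: "bool ^ 'd \<Rightarrow> complex ^ (bool ^ 'd) ^ (bool ^ 'd)" where
  "imaginary_adjacency_matrix x =
     (let A = adjacency_matrix cube; A' = dual_adjacency_matrix x
      in (- \<i> / 2) *\<^sub>m (A ** A' - A' ** A))"

end

theory Submission
  imports Defs
begin

text \<open>
  Write \<open>A\<close> as the sum over the coordinates \<open>i\<close> of the permutation matrices that flip the
  \<open>i\<close>-th entry, and the diagonal of \<open>A'\<close> at \<open>y\<close> as the sum of the signs \<open>s\<^sub>i(y) = \<plusminus>1\<close>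
  recording whether \<open>x\<close> and \<open>y\<close> agree at \<open>i\<close>. Adjacent vertices have diagonal entries
  differing by 2 in absolute value, which gives (ii). In (iii), the \<open>(y, z)\<close>-entry is a double
  sum over the pairs \<open>(i, j)\<close> whose successive flips lead from \<open>y\<close> to \<open>z\<close>; the terms with
  \<open>i \<noteq> j\<close> are antisymmetric in \<open>i\<close> and \<open>j\<close>, so that only the terms with \<open>i = j\<close> survive.
\<close>

definition flip :: "'d \<Rightarrow> bool ^ 'd \<Rightarrow> bool ^ 'd" where
  "flip i y = (\<chi> k. if k = i then \<not> y $ k else y $ k)"

lemma flip_nth: "flip i y $ k = (if k = i then \<not> y $ k else y $ k)"
  by (simp add: flip_def)

lemma flip_flip [simp]: "flip i (flip i y) = y"
  by (simp add: vec_eq_iff flip_nth)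

lemma flip_commute: "flip i (flip j y) = flip j (flip i y)"
  by (auto simp: vec_eq_iff flip_nth)

lemma flip_eq_iff [simp]: "flip i y = flip j y \<longleftrightarrow> i = j"
  by (auto simp: vec_eq_iff flip_nth)

text \<open>Makes adjacency an explicit move: two unequal Booleans are each other's negation, so the
  unique differing coordinate is the one to flip.\<close>

lemma ex1_differing_iff_flip: "(\<exists>!i. y $ i \<noteq> z $ i) \<longleftrightarrow> (\<exists>i. z = flip i y)"
proof
  assume "\<exists>!i. y $ i \<noteq> z $ i"
  then obtain i where "y $ i \<noteq> z $ i" "\<And>j. y $ j \<noteq> z $ j \<Longrightarrow> j = i" by metis
  then have "z $ k = flip i y $ k" for k
    unfolding flip_nth by metis
  then have "z = flip i y"
    by (simp add: vec_eq_iff)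
  then show "\<exists>i. z = flip i y" ..
next
  assume "\<exists>i. z = flip i y"
  then show "\<exists>!i. y $ i \<noteq> z $ i"
    by (metis flip_nth)
qed

lemma parcs_cube: "(y, z) \<in> parcs cube \<longleftrightarrow> (\<exists>i. z = flip i y)"
  by (simp add: cube_def flip: ex1_differing_iff_flip)

lemma pverts_cube [simp]: "pverts cube = UNIV"
  by (simp add: cube_def)

interpretation cube: pair_graph "cube :: (bool ^ 'd) pair_pre_digraph"
  by (rule pair_graph_cube)

definition differing :: "bool ^ 'd \<Rightarrow> bool ^ 'd \<Rightarrow> 'd set" where
  "differing y z = {i. y $ i \<noteq> z $ i}"

lemma differing_flip_left:
  "differing (flip i y) z =
    (if i \<in> differing y z then differing y z - {i} else insert i (differing y z))"
  by (auto simp: differing_def flip_nth split: if_splits)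

text \<open>An arc flips one coordinate and so removes at most one element from
  \<open>differing\<close>. This bounds the distance from below.\<close>

lemma card_differing_le_length:
  "cube.awalk y p z \<Longrightarrow> card (differing y z) \<le> length p"
proof (induction p arbitrary: y)
  case Nil
  then show ?case by (simp add: cube.awalk_Nil_iff differing_def)
next
  case (Cons e p)
  obtain i where "snd e = flip i y" and walk: "cube.awalk (flip i y) p z"
    using Cons.prems by (cases e) (auto simp: cube.awalk_Cons_iff parcs_cube)
  have "differing y z \<subseteq> insert i (differing (flip i y) z)"
    by (auto simp: differing_flip_left)
  then have "card (differing y z) \<le> card (insert i (differing (flip i y) z))"
    by (intro card_mono) auto
  also have "\<dots> \<le> Suc (card (differing (flip i y) z))"
    by (rule card_insert_le_m1) auto
  also have "\<dots> \<le> length (e # p)"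
    using Cons.IH[OF walk] by simp
  finally show ?case .
qed

text \<open>Flipping a differing coordinate at each step gives a shortest walk, which bounds the
  distance from above.\<close>

lemma ex_awalk_of_length_card_differing:
  "\<exists>p. cube.awalk y p z \<and> length p = card (differing y z)"
proof (induction "card (differing y z)" arbitrary: y)
  case 0
  then have "y = z" by (auto simp: differing_def vec_eq_iff)
  then show ?case
    using 0 by (intro exI[of _ "[]"]) (simp add: cube.awalk_Nil_iff)
next
  case (Suc n)
  then obtain i where i: "i \<in> differing y z"
    by (metis card.empty equals0I nat.distinct(1))
  then have "n = card (differing (flip i y) z)"
    using Suc.hyps(2) by (simp add: differing_flip_left)
  from Suc.hyps(1)[OF this] this
  obtain p where "cube.awalk (flip i y) p z" "length p = n" by auto
  then have "cube.awalk y ((y, flip i y) # p) z" "length ((y, flip i y) # p) = Suc n"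
    by (auto simp: cube.awalk_Cons_iff parcs_cube)
  then show ?case using Suc.hyps(2) by metis
qed

lemma path_dist_cube: "path_dist cube y z = card (differing y z)"
proof -
  have cost: "cube.awalk_cost (\<lambda>_. 1) p = length p" for p :: "((bool ^ 'd) \<times> (bool ^ 'd)) list"
    by (induction p) auto
  obtain p where p: "cube.awalk y p z" "length p = card (differing y z)"
    using ex_awalk_of_length_card_differing by blast
  have "cube.\<mu> (\<lambda>_. 1) y z = ereal (card (differing y z))"
  proof (rule antisym)
    show "cube.\<mu> (\<lambda>_. 1) y z \<le> ereal (card (differing y z))"
      using cube.min_cost_le_walk_cost[OF p(1), of "\<lambda>_. 1"] p(2) by (simp add: cost)
    show "ereal (card (differing y z)) \<le> cube.\<mu> (\<lambda>_. 1) y z"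
      unfolding cube.\<mu>_def by (intro INF_greatest) (simp add: cost card_differing_le_length)
  qed
  then show ?thesis by (simp add: path_dist_def)
qed

definition agreement :: "bool ^ 'd \<Rightarrow> bool ^ 'd \<Rightarrow> 'd \<Rightarrow> complex" where
  "agreement x y i = (if x $ i = y $ i then 1 else - 1)"

text \<open>The diagonal entry of \<open>A'\<close> at \<open>y\<close>, written as a sum of signs
  so that the effect of a flip can be read off.\<close>

definition dual_eigenvalue :: "bool ^ 'd \<Rightarrow> bool ^ 'd \<Rightarrow> complex" where
  "dual_eigenvalue x y = (\<Sum>i\<in>UNIV. agreement x y i)"

lemma dual_eigenvalue_conv_card:
  fixes x y :: "bool ^ 'd"
  shows "dual_eigenvalue x y = of_nat CARD('d) - 2 * of_nat (card (differing x y))"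
proof -
  have "agreement x y i = 1 - 2 * of_bool (i \<in> differing x y)" for i
    by (simp add: agreement_def differing_def)
  then show ?thesis
    by (simp add: dual_eigenvalue_def sum_subtractf flip: sum_distrib_left)
qed

lemma dual_adjacency_matrix_nth:
  "dual_adjacency_matrix x $ y $ z = (if y = z then dual_eigenvalue x y else 0)"
  by (simp add: dual_adjacency_matrix_def path_dist_cube dual_eigenvalue_conv_card)

lemma agreement_flip:
  "agreement x (flip i y) j = (if i = j then - agreement x y j else agreement x y j)"
  by (auto simp: agreement_def flip_nth)

lemma dual_eigenvalue_flip:
  "dual_eigenvalue x (flip i y) = dual_eigenvalue x y - 2 * agreement x y i"
proof -
  have "agreement x (flip i y) j = agreement x y j - (if j = i then 2 * agreement x y j else 0)" for j
    by (simp add: agreement_flip)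
  then show ?thesis
    by (simp add: dual_eigenvalue_def sum_subtractf)
qed

lemma agreement_square: "(agreement x y i)\<^sup>2 = 1"
  by (simp add: agreement_def)

lemma adjacency_matrix_cube_nth:
  "adjacency_matrix cube $ y $ z = (if \<exists>i. z = flip i y then 1 else 0)"
  by (simp add: adjacency_matrix_def parcs_cube)

text \<open>Flips of \<open>y\<close> at distinct coordinates are distinct vertices, so at most one
  summand is nonzero.\<close>

lemma adjacency_matrix_cube_nth_sum:
  "adjacency_matrix cube $ y $ z = (\<Sum>i\<in>UNIV. of_bool (z = flip i y))"
proof (cases "\<exists>i. z = flip i y")
  case True
  then obtain i where "z = flip i y" ..
  then show ?thesis by (auto simp: adjacency_matrix_cube_nth of_bool_def)
next
  case False
  then show ?thesis by (simp add: adjacency_matrix_cube_nth)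
qed

lemma sum_adjacency_matrix_cube:
  "(\<Sum>w\<in>UNIV. adjacency_matrix cube $ y $ w * f w) = (\<Sum>i\<in>UNIV. f (flip i y))"
proof -
  have "(\<Sum>w\<in>UNIV. adjacency_matrix cube $ y $ w * f w)
      = (\<Sum>w\<in>UNIV. \<Sum>i\<in>UNIV. of_bool (w = flip i y) * f w)"
    by (simp only: adjacency_matrix_cube_nth_sum sum_distrib_right)
  also have "\<dots> = (\<Sum>i\<in>UNIV. \<Sum>w\<in>UNIV. of_bool (w = flip i y) * f w)"
    by (rule sum.swap)
  also have "\<dots> = (\<Sum>i\<in>UNIV. f (flip i y))"
    by (simp add: of_bool_def if_distrib[of "\<lambda>c. c * _"] cong: if_cong)
  finally show ?thesis .
qed

lemma matrix_mult_dual_adjacency_matrix_nth: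
  "(M ** dual_adjacency_matrix x) $ y $ z = M $ y $ z * dual_eigenvalue x z"
  by (simp add: matrix_matrix_mult_def dual_adjacency_matrix_nth
      if_distrib[of "\<lambda>c. _ * c"] cong: if_cong)

lemma dual_adjacency_matrix_mult_nth:
  "(dual_adjacency_matrix x ** M) $ y $ z = dual_eigenvalue x y * M $ y $ z"
  by (simp add: matrix_matrix_mult_def dual_adjacency_matrix_nth
      if_distrib[of "\<lambda>c. c * _"] cong: if_cong)

text \<open>The diagonal matrix \<open>A'\<close> scales columns from the right and rows from the
  left, so a commutator with it multiplies each entry by a difference of diagonal entries.\<close>

lemma imaginary_adjacency_matrix_nth:
  "imaginary_adjacency_matrix x $ y $ z =
    - \<i> / 2 * adjacency_matrix cube $ y $ z * (dual_eigenvalue x z - dual_eigenvalue x y)"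
  by (simp add: imaginary_adjacency_matrix_def Let_def matrix_mult_dual_adjacency_matrix_nth
      dual_adjacency_matrix_mult_nth field_simps)

text \<open>Along an arc the difference is -2 times a sign; elsewhere both sides vanish.\<close>

lemma adjacency_matrix_cube_times_square_diff:
  "adjacency_matrix cube $ y $ z * (dual_eigenvalue x z - dual_eigenvalue x y)\<^sup>2
    = 4 * adjacency_matrix cube $ y $ z"
  by (auto simp: adjacency_matrix_cube_nth dual_eigenvalue_flip power_mult_distrib agreement_square)

text \<open>This is (iii) entrywise, up to the factor \<open>- \<i> / 2\<close>; \<open>w\<close> is
  the midpoint of a two-step walk from \<open>y\<close> to \<open>z\<close>.\<close>

lemma sum_second_difference:
  "(\<Sum>w\<in>UNIV. adjacency_matrix cube $ y $ w * (adjacency_matrix cube $ w $ z *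
      (2 * dual_eigenvalue x w - dual_eigenvalue x y - dual_eigenvalue x z)))
    = (if y = z then - 4 * dual_eigenvalue x y else 0)"
proof -
  define s where "s = agreement x y"
  \<comment> \<open>\<open>P i j\<close> indicates that flipping \<open>i\<close> and then
    \<open>j\<close> leads from \<open>y\<close> to \<open>z\<close>.\<close>
  define P where "P i j = (of_bool (z = flip j (flip i y)) :: complex)" for i j
  have P_commute: "P i j = P j i" for i j
    by (simp add: P_def flip_commute)
  have antisym: "(\<Sum>i\<in>UNIV. \<Sum>j\<in>UNIV. P i j * (s j - s i)) = 0"
  proof -
    have "(\<Sum>i\<in>UNIV. \<Sum>j\<in>UNIV. P i j * s j) = (\<Sum>i\<in>UNIV. \<Sum>j\<in>UNIV. P i j * s i)"
      by (subst sum.swap) (simp add: P_commute)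
    then show ?thesis
      by (simp add: right_diff_distrib sum_subtractf)
  qed
  \<comment> \<open>Write \<theta> for \<open>dual_eigenvalue x\<close>. If
    \<open>i \<noteq> j\<close>, then \<theta> at \<open>z\<close> is \<theta> at \<open>y\<close>
    minus \<open>2 * s i + 2 * s j\<close>, leaving \<open>2 * (s j - s i)\<close>. If
    \<open>i = j\<close>, the walk returns to \<open>y\<close>, leaving
    \<open>- 4 * s i\<close>.\<close>
  have summand: "P i j * (2 * dual_eigenvalue x (flip i y) - dual_eigenvalue x y - dual_eigenvalue x z)
      = 2 * (P i j * (s j - s i)) - (if j = i then of_bool (y = z) * (4 * s i) else 0)" for i j
    by (auto simp: P_def s_def dual_eigenvalue_flip agreement_flip algebra_simps)
  have "(\<Sum>w\<in>UNIV. adjacency_matrix cube $ y $ w * (adjacency_matrix cube $ w $ z *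
      (2 * dual_eigenvalue x w - dual_eigenvalue x y - dual_eigenvalue x z)))
    = (\<Sum>i\<in>UNIV. \<Sum>j\<in>UNIV.
        P i j * (2 * dual_eigenvalue x (flip i y) - dual_eigenvalue x y - dual_eigenvalue x z))"
    unfolding sum_adjacency_matrix_cube
    by (simp only: adjacency_matrix_cube_nth_sum sum_distrib_right P_def)
  also have "\<dots> = 2 * (\<Sum>i\<in>UNIV. \<Sum>j\<in>UNIV. P i j * (s j - s i))
      - of_bool (y = z) * (4 * (\<Sum>i\<in>UNIV. s i))"
    unfolding summand by (simp add: sum_subtractf sum_distrib_left)
  also have "\<dots> = (if y = z then - 4 * dual_eigenvalue x y else 0)"
    unfolding antisym by (simp add: s_def dual_eigenvalue_def)
  finally show ?thesis .
qed

theorem lemma6p3: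
  fixes x :: "bool ^ 'd"
    and A A' A\<epsilon> :: "complex ^ (bool ^ 'd) ^ (bool ^ 'd)"
  assumes "x = (\<chi> i. False)"
    and "A = adjacency_matrix cube"
    and "A' = dual_adjacency_matrix x"
    and "A\<epsilon> = imaginary_adjacency_matrix x"
  shows "A ** A' - A' ** A = (2 * \<i>) *\<^sub>m A\<epsilon> \<and>
         A' ** A\<epsilon> - A\<epsilon> ** A' = (2 * \<i>) *\<^sub>m A \<and>
         A\<epsilon> ** A - A ** A\<epsilon> = (2 * \<i>) *\<^sub>m A'"
proof (intro conjI)
  let ?\<theta> = "dual_eigenvalue x"
  have A\<epsilon>: "A\<epsilon> $ y $ z = - \<i> / 2 * A $ y $ z * (?\<theta> z - ?\<theta> y)" for y z
    unfolding assms(2,4) by (rule imaginary_adjacency_matrix_nth)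
  \<comment> \<open>The definition of \<open>A\<epsilon>\<close> solved for the commutator, as
    \<open>2 * \<i>\<close> times \<open>- \<i> / 2\<close> is 1.\<close>
  show "A ** A' - A' ** A = (2 * \<i>) *\<^sub>m A\<epsilon>"
    by (simp add: vec_eq_iff A\<epsilon> assms(3) matrix_mult_dual_adjacency_matrix_nth
        dual_adjacency_matrix_mult_nth field_simps)
  show "A' ** A\<epsilon> - A\<epsilon> ** A' = (2 * \<i>) *\<^sub>m A"
  proof -
    \<comment> \<open>The second commutator with \<open>A'\<close> squares the difference; its value
      4 on arcs turns \<open>\<i> / 2\<close> into \<open>2 * \<i>\<close>.\<close>
    have "(A' ** A\<epsilon> - A\<epsilon> ** A') $ y $ z = \<i> / 2 * (A $ y $ z * (?\<theta> z - ?\<theta> y)\<^sup>2)" for y z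
      by (simp add: A\<epsilon> assms(3) matrix_mult_dual_adjacency_matrix_nth
          dual_adjacency_matrix_mult_nth power2_eq_square field_simps)
    then show ?thesis
      by (simp add: vec_eq_iff assms(2) adjacency_matrix_cube_times_square_diff)
  qed
  show "A\<epsilon> ** A - A ** A\<epsilon> = (2 * \<i>) *\<^sub>m A'"
  proof -
    \<comment> \<open>The two products contribute \<open>?\<theta> w - ?\<theta> y\<close> and
      \<open>?\<theta> z - ?\<theta> w\<close>; subtracting them gives the second
      difference.\<close>
    have "(A\<epsilon> ** A - A ** A\<epsilon>) $ y $ z
        = - \<i> / 2 * (\<Sum>w\<in>UNIV. A $ y $ w * (A $ w $ z * (2 * ?\<theta> w - ?\<theta> y - ?\<theta> z)))" for y z
      unfolding matrix_matrix_mult_def sum_distrib_left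
      by (simp add: A\<epsilon> flip: sum_subtractf) (intro sum.cong refl, simp add: field_simps)
    then show ?thesis
      by (simp add: vec_eq_iff assms(2,3) sum_second_difference dual_adjacency_matrix_nth)
  qed
qed

end
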